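(* Let $n\ge 2$ be an integer. The lattice polytope $Q_n$ is Gorenstein of codegree $n$ and has normalized volume $n$.
   Context: Polytope $Q_n$: let $I$ be the $n\times n$ identity matrix and let $R$ be the $n\times n$ matrix, with rows and columns indexed by $0,\ldots,n-1$, whose entry at $(i,j)$ is $1$ if $j\equiv i+1\bmod n$ and $0$ otherwise. Then $Q_n\subset\mathbb{R}^{n^2}$ is the convex hull of the rows of the $2n\times n^2$ block matrix $$\begin{bmatrix} I & I & I & \cdots & I\\ I & R^1 & R^2 & \cdots & R^{n-1}\end{bmatrix}.$$ A lattice polytope is a polytope whose vertices lie in the lattice; here the lattice is $\mathbb{Z}^{n^2}$. Since $Q_n$ is not full-dimensional, all lattice notions are taken relative to the lattice induced by $\mathbb{Z}^{n^2}$ on the affine hull of the polytope, and interiors are relative interiors. A $d$-dimensional lattice polytope $P$ in $\mathbb{R}^d$ containing $0$ in its interior is reflexive if its polar polytope $P^*=\{x\in\mathbb{R}^d : \langle x,v\rangle\ge -1 \text{ for all } v\in P\}$ is again a lattice polytope (with respect to the dual lattice). A lattice polytope $P$ is a Gorenstein polytope of codegree $k$ if $k$ is a positive integer and there is an interior lattice point $m$ of $kP$ such that $kP-m$ is a reflexive polytope (with respect to the lattice in the linear span of $kP-m$). The normalized volume is the volume form which assigns volume $1$ to the standard simplex; for $Q_n$ it is normalized so that a simplex of dimension $\dim Q_n$ in the affine hull of $Q_n$ that is unimodular with respect to $\operatorname{aff}(Q_n)\cap\mathbb{Z}^{n^2}$ has volume $1$. *)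

theory Defs
  imports "HOL-Analysis.Analysis" "Berlekamp_Zassenhaus.Finite_Field"
begin

text \<open>
  The dimension \<open>n\<close> is \<open>CARD('n)\<close>, where the class \<open>nontriv\<close> says \<open>CARD('n) > 1\<close>. The type
  \<open>'n mod_ring\<close> consists of the residues \<open>0, \<dots>, n - 1\<close> with addition modulo \<open>n\<close>, and it
  indexes the rows and columns of the \<open>n \<times> n\<close> matrices as well as the \<open>n\<close> block columns.
\<close>

definition shift_matrix :: "real ^ 'n::nontriv mod_ring ^ 'n mod_ring" where
  "shift_matrix = (\<chi> i j. if j = i + 1 then 1 else 0)"

(* The overloaded power on real ^ 'm ^ 'm is componentwise, so it cannot be used here. *)
definition matrix_power :: "real ^ 'm ^ 'm \<Rightarrow> nat \<Rightarrow> real ^ 'm::finite ^ 'm" where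
  "matrix_power A k = (((**) A) ^^ k) (mat 1)"

text \<open>
  Column \<open>(k, j)\<close> is column \<open>j\<close> of block column \<open>k\<close>; row \<open>Inl i\<close> is row \<open>i\<close> of the upper blocks,
  row \<open>Inr i\<close> is row \<open>i\<close> of the lower blocks. The zeroth power is the identity, which accounts
  for the lower left block.
\<close>
definition Q_matrix ::
  "real ^ ('n::nontriv mod_ring \<times> 'n mod_ring) ^ ('n mod_ring + 'n mod_ring)" where
  "Q_matrix = (\<chi> r c. case (r, c) of
      (Inl i, (k, j)) \<Rightarrow> mat 1 $ i $ j
    | (Inr i, (k, j)) \<Rightarrow> matrix_power shift_matrix (nat (to_int_mod_ring k)) $ i $ j)"

definition Q_polytope :: "(real ^ ('n::nontriv mod_ring \<times> 'n mod_ring)) set" where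
  "Q_polytope = convex hull (rows Q_matrix)"

definition integer_lattice :: "(real ^ 'm::finite) set" where
  "integer_lattice = {x. \<forall>i. x $ i \<in> \<int>}"

definition lattice_polytope :: "'a::euclidean_space set \<Rightarrow> 'a set \<Rightarrow> bool" where
  "lattice_polytope L P \<longleftrightarrow> polytope P \<and> (\<forall>v. v extreme_point_of P \<longrightarrow> v \<in> L)"

text \<open>
  In the next three definitions a polytope \<open>P\<close> with \<open>0\<close> in its relative interior is regarded as a
  full-dimensional polytope in \<open>span P\<close> with lattice \<open>L \<inter> span P\<close>. The dual space of \<open>span P\<close> is
  identified with \<open>span P\<close> through the inner product.
\<close>
definition polar_polytope :: "'a::euclidean_space set \<Rightarrow> 'a set" where
  "polar_polytope P = {x \<in> span P. \<forall>v\<in>P. x \<bullet> v \<ge> -1}"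

definition dual_lattice :: "'a::euclidean_space set \<Rightarrow> 'a set \<Rightarrow> 'a set" where
  "dual_lattice V L = {x \<in> V. \<forall>l \<in> L \<inter> V. x \<bullet> l \<in> \<int>}"

definition reflexive_polytope :: "'a::euclidean_space set \<Rightarrow> 'a set \<Rightarrow> bool" where
  "reflexive_polytope L P \<longleftrightarrow>
     lattice_polytope (L \<inter> span P) P \<and> 0 \<in> rel_interior P \<and>
     lattice_polytope (dual_lattice (span P) L) (polar_polytope P)"

definition Gorenstein_polytope :: "'a::euclidean_space set \<Rightarrow> 'a set \<Rightarrow> nat \<Rightarrow> bool" where
  "Gorenstein_polytope L P k \<longleftrightarrow>
     lattice_polytope L P \<and> k > 0 \<and>
     (\<exists>m \<in> L \<inter> rel_interior ((*\<^sub>R) (real k) ` P).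
        reflexive_polytope L ((\<lambda>x. real k *\<^sub>R x - m) ` P))"

text \<open>
  A lattice frame consists of an origin \<open>p\<close> and vectors \<open>b 0, \<dots>, b (d - 1)\<close>, where \<open>d\<close> is the
  dimension of \<open>P\<close>, that identify the lattice of the affine hull of \<open>P\<close> with the integer points of
  \<open>d\<close>-dimensional coordinate space.
\<close>
definition lattice_frame ::
  "'a::euclidean_space set \<Rightarrow> 'a set \<Rightarrow> 'a \<Rightarrow> (nat \<Rightarrow> 'a) \<Rightarrow> bool" where
  "lattice_frame L P p b \<longleftrightarrow>
     (let d = nat (aff_dim P) in
        inj_on b {..<d} \<and> independent (b ` {..<d}) \<and>
        L \<inter> affine hull P = {p + (\<Sum>i<d. of_int (c i) *\<^sub>R b i) |c. c \<in> (UNIV :: (nat \<Rightarrow> int) set)})"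

text \<open>
  The normalized volume is \<open>d!\<close> times the Lebesgue measure of \<open>P\<close> in the coordinates of a lattice
  frame, so that the simplex with vertices \<open>p, p + b 0, \<dots>, p + b (d - 1)\<close> has volume \<open>1\<close>. Two
  frames differ by a unimodular affine map, so the value does not depend on the frame. A product
  measure is used because \<open>d\<close> depends on \<open>P\<close> and so cannot be the dimension of a type.
\<close>
definition frame_volume :: "'a::euclidean_space set \<Rightarrow> 'a \<Rightarrow> (nat \<Rightarrow> 'a) \<Rightarrow> real" where
  "frame_volume P p b =
     (let d = nat (aff_dim P); M = (\<Pi>\<^sub>M i\<in>{..<d}. lborel :: real measure) in
        fact d * measure M {x \<in> space M. p + (\<Sum>i<d. x i *\<^sub>R b i) \<in> P})"

definition normalized_volume :: "'a::euclidean_space set \<Rightarrow> 'a set \<Rightarrow> real" where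
  "normalized_volume L P = (THE v. \<exists>p b. lattice_frame L P p b \<and> v = frame_volume P p b)"

end

theory Submission
  imports Defs
begin

text \<open>
  In block column \<open>k\<close> and column \<open>j\<close>, put \<open>a = j\<close> and \<open>b = j - k\<close>. In the coordinates \<open>(a, b)\<close> the
  upper rows of the matrix are the indicators of \<open>a = i\<close> and the lower rows are the indicators of
  \<open>b = i\<close>, so the combination of the rows with weights \<open>\<alpha>\<close> (upper) and \<open>\<beta>\<close> (lower) is the
  point \<open>\<alpha> a + \<beta> b\<close>. Weights of the same point differ by moving a constant from \<open>\<beta>\<close> to \<open>\<alpha>\<close>; this
  is the only relation among the \<open>2 n\<close> rows, so the dimension of the polytope is \<open>2 n - 2\<close>. It also
  keeps the total weight, because there are as many upper rows as lower rows.

  Moving the smallest lower weight to \<open>\<alpha>\<close> shows that the polytope is the part of its affine hull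
  where all coordinates are nonnegative (\<open>Q_polytope_halfspaces\<close>). The \<open>n\<close>-th dilate minus the
  all-ones vector is therefore \<open>{y \<in> V. \<forall>i. y i \<ge> -1}\<close>, where \<open>V\<close> is the linear space of weights
  with sum zero. By bipolarity (\<open>polar_polytope_halfspaces\<close>) its polar is the convex hull of the
  orthogonal projections to \<open>V\<close> of the unit vectors. These represent the coordinate functionals
  on \<open>V\<close>, so they lie in the dual lattice. They sum to zero, because the coordinates of a point of
  \<open>V\<close> do, and hence \<open>0\<close> lies in their convex hull.

  For the volume, choose for each lower vertex \<open>j\<close> the weights with \<open>\<beta> j = 0\<close>. A point with integer
  coordinates then has integer weights, so the remaining \<open>2 n - 1\<close> vertices span a unimodular
  simplex (\<open>lattice_frame_omitted_vertex\<close>). The points of the polytope for which \<open>j\<close> has the smallest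
  lower weight form exactly this simplex. The \<open>n\<close> simplices obtained in this way cover the polytope
  and overlap in null sets, and each one has normalized volume \<open>1\<close> in its own frame. That volumes may
  be compared across frames, and that the normalized volume is well defined at all, is
  \<open>emeasure_frame_unique\<close>: the transition between two frames is an affine map whose linear part is an
  integer matrix of determinant \<open>1\<close> or \<open>-1\<close>.
\<close>

section \<open>Lebesgue measure in lattice coordinates\<close>

lemma measurable_vec_of_coordinates:
  fixes r :: "'d::finite \<Rightarrow> nat"
  assumes r: "bij_betw r UNIV {..<d}"
  shows "(\<lambda>x. (\<chi> i. x (r i)) :: real ^ 'd) \<in> borel_measurable (\<Pi>\<^sub>M i\<in>{..<d}. lborel)"
proof (rule borel_measurable_euclidean_space[THEN iffD2], rule ballI)
  fix v :: "real ^ 'd" assume "v \<in> Basis"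
  then obtain i where v: "v = axis i 1" by (auto simp: Basis_vec_def)
  have "r i \<in> {..<d}" using r by (auto simp: bij_betw_def)
  then show "(\<lambda>x. ((\<chi> i. x (r i)) :: real ^ 'd) \<bullet> v) \<in> borel_measurable (\<Pi>\<^sub>M i\<in>{..<d}. lborel)"
    by (simp add: v inner_axis)
qed

text \<open>
  The change of variables formula is a statement about the types \<open>real ^ 'd\<close>, while frame volumes are
  measured on \<open>{..<d} \<rightarrow> real\<close>; this lemma carries measures from one to the other.
\<close>
lemma lborel_vec_eq_distr_PiM:
  fixes r :: "'d::finite \<Rightarrow> nat"
  assumes r: "bij_betw r UNIV {..<d}"
  shows "(lborel :: (real ^ 'd) measure) =
    distr (\<Pi>\<^sub>M i\<in>{..<d}. lborel) borel (\<lambda>x. \<chi> i. x (r i))"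
    (is "_ = distr ?M borel ?f")
proof (rule lborel_eqI)
  have meas: "?f \<in> measurable ?M borel"
    using r by (rule measurable_vec_of_coordinates)
  fix l u :: "real ^ 'd"
  assume "\<And>v. v \<in> Basis \<Longrightarrow> l \<bullet> v \<le> u \<bullet> v"
  then have le: "l $ i \<le> u $ i" for i
    by (metis axis_in_Basis_iff cart_eq_inner_axis inner_axis_axis insert_iff Basis_real_def singleton_iff)
  interpret product_sigma_finite "\<lambda>_::nat. lborel :: real measure"
    by standard
  let ?s = "the_inv_into UNIV r"
  have s: "?s (r i) = i" for i
    using r by (simp add: bij_betw_def the_inv_into_f_f)
  have sr: "r (?s k) = k" if "k < d" for k
    using r that by (simp add: bij_betw_def f_the_inv_into_f)
  have "?f -` box l u \<inter> space ?M = PiE {..<d} (\<lambda>k. {l $ ?s k <..< u $ ?s k})" (is "?L = ?R")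
  proof (intro equalityI subsetI)
    fix x assume x: "x \<in> ?L"
    have "x k \<in> {l $ ?s k <..< u $ ?s k}" if "k < d" for k
    proof -
      have "l $ ?s k < x (r (?s k)) \<and> x (r (?s k)) < u $ ?s k"
        using x by (simp add: mem_box_cart)
      then show ?thesis by (simp add: sr[OF that])
    qed
    then show "x \<in> ?R" using x by (simp add: space_PiM PiE_iff)
  next
    fix x assume x: "x \<in> ?R"
    have "r i \<in> {..<d}" for i using r by (auto simp: bij_betw_def)
    then have "l $ ?s (r i) < x (r i) \<and> x (r i) < u $ ?s (r i)" for i
      using x by (auto simp: PiE_def Pi_def)
    then show "x \<in> ?L" using x
      by (auto simp: mem_box_cart space_PiM PiE_def s)
  qed
  then have "emeasure (distr ?M borel ?f) (box l u) =
      emeasure ?M (PiE {..<d} (\<lambda>k. {l $ ?s k <..< u $ ?s k}))"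
    using meas by (simp add: emeasure_distr)
  also have "\<dots> = (\<Prod>k<d. emeasure lborel {l $ ?s k <..< u $ ?s k})"
    by (rule emeasure_PiM) auto
  also have "\<dots> = (\<Prod>k<d. ennreal (u $ ?s k - l $ ?s k))"
    using le by simp
  also have "\<dots> = (\<Prod>i\<in>UNIV. ennreal (u $ i - l $ i))"
    using prod.reindex_bij_betw[OF r, of "\<lambda>k. ennreal (u $ ?s k - l $ ?s k)"] by (simp add: s)
  also have "\<dots> = ennreal (\<Prod>i\<in>UNIV. u $ i - l $ i)"
    using le by (simp add: prod_ennreal)
  also have "(\<Prod>i\<in>UNIV. u $ i - l $ i) = (\<Prod>v\<in>Basis. (u - l) \<bullet> v)"
  proof -
    have B: "(Basis :: (real ^ 'd) set) = range (\<lambda>i. axis i 1)"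
      by (auto simp: Basis_vec_def)
    have "inj (\<lambda>i. axis i 1 :: real ^ 'd)"
      by (auto simp: inj_on_def axis_eq_axis)
    then show ?thesis
      unfolding B by (simp add: prod.reindex inner_axis)
  qed
  finally show "emeasure (distr ?M borel ?f) (box l u) = ennreal (\<Prod>v\<in>Basis. (u - l) \<bullet> v)" .
qed simp

lemma det_in_Ints:
  fixes A :: "real ^ 'd::finite ^ 'd"
  assumes "\<And>i j. A $ i $ j \<in> \<int>"
  shows "det A \<in> \<int>"
  unfolding det_def using assms by (intro Ints_sum Ints_mult Ints_prod) auto

lemma abs_det_unimodular:
  fixes A B :: "real ^ 'd::finite ^ 'd"
  assumes AB: "A ** B = mat 1"
    and A: "\<And>i j. A $ i $ j \<in> \<int>" and B: "\<And>i j. B $ i $ j \<in> \<int>"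
  shows "\<bar>det A\<bar> = 1"
proof -
  obtain a where a: "det A = of_int a" using det_in_Ints[OF A] by (auto elim: Ints_cases)
  obtain b where b: "det B = of_int b" using det_in_Ints[OF B] by (auto elim: Ints_cases)
  have "det A * det B = 1" using AB by (metis det_I det_mul)
  then have "a * b = 1" unfolding a b by (metis of_int_eq_1_iff of_int_mult)
  then have "\<bar>a\<bar> = 1" by (auto simp: zmult_eq_1_iff)
  then show ?thesis unfolding a by (metis of_int_1 of_int_abs)
qed

text \<open>
  For measurable sets of finite measure this is the formula for the measure of a linear image. Since
  the matrix is invertible, one side is finite if and only if the other one is.
\<close>
lemma emeasure_lborel_unimodular:
  fixes A B :: "real ^ 'd::{finite,wellorder} ^ 'd::_"
  assumes AB: "A ** B = mat 1"
    and A: "\<And>i j. A $ i $ j \<in> \<int>" and B: "\<And>i j. B $ i $ j \<in> \<int>"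
    and S: "S \<in> sets borel"
  shows "emeasure lborel ((\<lambda>x. c + A *v x) -` S) = emeasure lborel S"
proof -
  let ?T = "(\<lambda>x. c + A *v x) -` S"
  have BA: "B ** A = mat 1" using AB by (simp add: matrix_left_right_inverse)
  have "(\<lambda>x. c + A *v x) \<in> borel_measurable borel"
    by (intro borel_measurable_continuous_onI continuous_intros linear_continuous_on)
       (simp add: linear_conv_bounded_linear[symmetric])
  then have T: "?T \<in> sets borel" using S measurable_sets_borel by blast
  have S_eq: "S = (+) c ` (*v) A ` ?T"
  proof -
    have "A *v (B *v y) = y" for y
      using AB by (simp add: matrix_vector_mul_assoc)
    then have inv: "x = c + A *v (B *v (x - c))" for x by simp
    show ?thesis
    proof
      show "S \<subseteq> (+) c ` (*v) A ` ?T"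
      proof
        fix x assume "x \<in> S"
        then have "B *v (x - c) \<in> ?T" using inv[of x] by simp
        then show "x \<in> (+) c ` (*v) A ` ?T" using inv[of x] by blast
      qed
    qed auto
  qed
  have T_eq: "?T = (*v) B ` (+) (-c) ` S"
  proof -
    have "B *v (A *v y) = y" for y
      using BA by (simp add: matrix_vector_mul_assoc)
    then have inv: "x = B *v (- c + (c + A *v x))" for x by simp
    show ?thesis
    proof
      show "?T \<subseteq> (*v) B ` (+) (- c) ` S"
      proof
        fix x assume "x \<in> ?T"
        then show "x \<in> (*v) B ` (+) (- c) ` S" using inv[of x] by blast
      qed
      show "(*v) B ` (+) (- c) ` S \<subseteq> ?T"
        by (subst S_eq) (use inv in auto)
    qed
  qed
  have lin: "linear ((*v) A)" "linear ((*v) B)" by auto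
  have iff: "S \<in> lmeasurable \<longleftrightarrow> ?T \<in> lmeasurable"
  proof
    assume "S \<in> lmeasurable"
    then show "?T \<in> lmeasurable"
      unfolding T_eq by (intro measurable_linear_image lin measurable_translation)
  next
    assume T: "?T \<in> lmeasurable"
    show "S \<in> lmeasurable"
      by (subst S_eq) (intro measurable_linear_image lin measurable_translation T)
  qed
  have eqS: "emeasure lborel S = emeasure lebesgue S"
    "emeasure lborel ?T = emeasure lebesgue ?T"
    using S T by auto
  show ?thesis
  proof (cases "S \<in> lmeasurable")
    case True
    then have Tm: "?T \<in> lmeasurable" using iff by simp
    have "measure lebesgue S = measure lebesgue ((*v) A ` ?T)"
      by (subst S_eq) (rule measure_translation)
    also have "\<dots> = \<bar>det A\<bar> * measure lebesgue ?T"
      using measure_linear_image[OF lin(1) Tm] by simp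
    finally have "measure lebesgue S = measure lebesgue ?T"
      using abs_det_unimodular[OF AB A B] by simp
    then show ?thesis
      unfolding eqS using True Tm by (simp add: emeasure_eq_measure2 fmeasurableD2)
  next
    case False
    have "emeasure lebesgue X = \<infinity>" if "X \<in> sets borel" "X \<notin> lmeasurable" for X :: "(real, 'd) vec set"
      using that by (auto simp: fmeasurable_def less_top[symmetric])
    then show ?thesis unfolding eqS using False iff S T by simp
  qed
qed

text \<open>
  Both families of vectors generate the same lattice, so each is an integer combination of the other;
  by independence the two integer matrices are inverse to each other.
\<close>
lemma unimodular_change_of_frame:
  fixes \<beta> \<beta>' :: "'d::finite \<Rightarrow> 'a::real_vector"
  assumes indep: "\<And>x. (\<Sum>i\<in>UNIV. x i *\<^sub>R \<beta> i) = 0 \<Longrightarrow> x = (\<lambda>_. 0)"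
    and indep': "\<And>x. (\<Sum>i\<in>UNIV. x i *\<^sub>R \<beta>' i) = 0 \<Longrightarrow> x = (\<lambda>_. 0)"
    and lattice: "range (\<lambda>c :: 'd \<Rightarrow> int. p + (\<Sum>i\<in>UNIV. of_int (c i) *\<^sub>R \<beta> i)) =
      range (\<lambda>c :: 'd \<Rightarrow> int. p' + (\<Sum>i\<in>UNIV. of_int (c i) *\<^sub>R \<beta>' i))"
  obtains c :: "real ^ 'd" and A B :: "real ^ 'd ^ 'd" where "A ** B = mat 1"
    and "\<And>i j. A $ i $ j \<in> \<int>" and "\<And>i j. B $ i $ j \<in> \<int>"
    and "\<And>x. p' + (\<Sum>i\<in>UNIV. x $ i *\<^sub>R \<beta>' i) = p + (\<Sum>i\<in>UNIV. (c + A *v x) $ i *\<^sub>R \<beta> i)"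
proof -
  \<comment> \<open>The frame vectors of each frame are differences of lattice points, so they have integer
    coordinates in the other frame.\<close>
  have transition: "\<exists>(c :: 'd \<Rightarrow> int) A :: 'd \<Rightarrow> 'd \<Rightarrow> int. q' = q + (\<Sum>i\<in>UNIV. of_int (c i) *\<^sub>R \<gamma> i) \<and>
      (\<forall>k. \<gamma>' k = (\<Sum>i\<in>UNIV. of_int (A i k) *\<^sub>R \<gamma> i))"
    if eq: "range (\<lambda>c :: 'd \<Rightarrow> int. q + (\<Sum>i\<in>UNIV. of_int (c i) *\<^sub>R \<gamma> i)) =
      range (\<lambda>c :: 'd \<Rightarrow> int. q' + (\<Sum>i\<in>UNIV. of_int (c i) *\<^sub>R \<gamma>' i))"
    for q q' :: 'a and \<gamma> \<gamma>'
  proof -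
    have "q' + (\<Sum>i\<in>UNIV. of_int ((\<lambda>_. 0) i) *\<^sub>R \<gamma>' i) \<in> range (\<lambda>c :: 'd \<Rightarrow> int. q + (\<Sum>i\<in>UNIV. of_int (c i) *\<^sub>R \<gamma> i))"
      unfolding eq by (rule rangeI)
    then obtain c :: "'d \<Rightarrow> int" where c: "q' = q + (\<Sum>i\<in>UNIV. of_int (c i) *\<^sub>R \<gamma> i)" by auto
    have "\<exists>a :: 'd \<Rightarrow> int. \<gamma>' k = (\<Sum>i\<in>UNIV. of_int (a i) *\<^sub>R \<gamma> i)" for k
    proof -
      have "q' + (\<Sum>i\<in>UNIV. of_int ((\<lambda>i. if i = k then 1 else 0) i) *\<^sub>R \<gamma>' i) \<in>
          range (\<lambda>c :: 'd \<Rightarrow> int. q + (\<Sum>i\<in>UNIV. of_int (c i) *\<^sub>R \<gamma> i))"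
        unfolding eq by (rule rangeI)
      then obtain e :: "'d \<Rightarrow> int" where "q' + \<gamma>' k = q + (\<Sum>i\<in>UNIV. of_int (e i) *\<^sub>R \<gamma> i)"
        by (auto simp: if_distrib[of of_int] if_distrib[of "\<lambda>x. x *\<^sub>R _"] cong: if_cong)
      then have "\<gamma>' k = (\<Sum>i\<in>UNIV. of_int (e i - c i) *\<^sub>R \<gamma> i)"
        unfolding c by (simp add: algebra_simps sum_subtractf)
      then show ?thesis by (intro exI[of _ "\<lambda>i. e i - c i"])
    qed
    then obtain A where "\<forall>k. \<gamma>' k = (\<Sum>i\<in>UNIV. of_int ((A k i) :: int) *\<^sub>R \<gamma> i)" by metis
    then show ?thesis using c by (intro exI[of _ c] exI[of _ "\<lambda>i k. A k i"]) simp
  qed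
  obtain c :: "'d \<Rightarrow> int" and A :: "'d \<Rightarrow> 'd \<Rightarrow> int" where c: "p' = p + (\<Sum>i\<in>UNIV. of_int (c i) *\<^sub>R \<beta> i)"
    and A: "\<And>k. \<beta>' k = (\<Sum>i\<in>UNIV. of_int (A i k) *\<^sub>R \<beta> i)"
    using transition[OF lattice] by auto
  obtain B :: "'d \<Rightarrow> 'd \<Rightarrow> int" where B: "\<And>k. \<beta> k = (\<Sum>i\<in>UNIV. of_int (B i k) *\<^sub>R \<beta>' i)"
    using transition[OF lattice[symmetric]] by auto
  define MA :: "real ^ 'd ^ 'd" where "MA = (\<chi> i j. of_int (A i j))"
  define MB :: "real ^ 'd ^ 'd" where "MB = (\<chi> i j. of_int (B i j))"
  have change: "(\<Sum>k\<in>UNIV. x $ k *\<^sub>R (\<Sum>i\<in>UNIV. of_int (C i k) *\<^sub>R \<gamma> i)) =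
      (\<Sum>i\<in>UNIV. ((\<chi> i j. of_int (C i j)) *v x) $ i *\<^sub>R \<gamma> i)"
    for x :: "real ^ 'd" and C :: "'d \<Rightarrow> 'd \<Rightarrow> int" and \<gamma> :: "'d \<Rightarrow> 'a"
  proof -
    have "(\<Sum>k\<in>UNIV. x $ k *\<^sub>R (\<Sum>i\<in>UNIV. of_int (C i k) *\<^sub>R \<gamma> i)) =
        (\<Sum>k\<in>UNIV. \<Sum>i\<in>UNIV. (of_int (C i k) * x $ k) *\<^sub>R \<gamma> i)"
      by (simp add: scaleR_sum_right mult.commute)
    also have "\<dots> = (\<Sum>i\<in>UNIV. \<Sum>k\<in>UNIV. (of_int (C i k) * x $ k) *\<^sub>R \<gamma> i)"
      by (rule sum.swap)
    finally show ?thesis by (simp add: matrix_vector_mult_def scaleR_sum_left)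
  qed
  have toA: "(\<Sum>k\<in>UNIV. x $ k *\<^sub>R \<beta>' k) = (\<Sum>i\<in>UNIV. (MA *v x) $ i *\<^sub>R \<beta> i)" for x
    unfolding MA_def change[symmetric] A[symmetric] ..
  have toB: "(\<Sum>k\<in>UNIV. x $ k *\<^sub>R \<beta> k) = (\<Sum>i\<in>UNIV. (MB *v x) $ i *\<^sub>R \<beta>' i)" for x
    unfolding MB_def change[symmetric] B[symmetric] ..
  have "MA *v (MB *v x) = x" for x
  proof -
    have "(\<Sum>i\<in>UNIV. ((MA *v (MB *v x)) $ i - x $ i) *\<^sub>R \<beta> i) = 0"
      using toA[of "MB *v x"] toB[of x] by (simp add: algebra_simps sum_subtractf)
    from indep[OF this] show ?thesis by (simp add: fun_eq_iff vec_eq_iff)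
  qed
  then have AB: "MA ** MB = mat 1"
    by (simp add: matrix_eq flip: matrix_vector_mul_assoc)
  show thesis
  proof (rule that[OF AB])
    show "MA $ i $ j \<in> \<int>" "MB $ i $ j \<in> \<int>" for i j by (simp_all add: MA_def MB_def)
    show "p' + (\<Sum>i\<in>UNIV. x $ i *\<^sub>R \<beta>' i) = p + (\<Sum>i\<in>UNIV. ((\<chi> i. of_int (c i)) + MA *v x) $ i *\<^sub>R \<beta> i)" for x
      unfolding c toA by (simp add: algebra_simps sum.distrib)
  qed
qed

lemma independent_family_sum_zero:
  fixes b :: "nat \<Rightarrow> 'a::real_vector" and r :: "'d::finite \<Rightarrow> nat"
  assumes r: "bij_betw r UNIV {..<d}" and inj: "inj_on b {..<d}" and ind: "independent (b ` {..<d})"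
    and sum: "(\<Sum>i\<in>UNIV. x i *\<^sub>R b (r i)) = 0"
  shows "x = (\<lambda>_. 0)"
proof
  fix i
  have inj': "inj (\<lambda>i. b (r i))"
    using comp_inj_on[of r UNIV b] r inj by (simp add: bij_betw_def comp_def)
  have im: "range (\<lambda>i. b (r i)) = b ` {..<d}"
    using image_image[of b r UNIV] bij_betw_imp_surj_on[OF r] by simp
  have inv: "the_inv (\<lambda>i. b (r i)) (b (r j)) = j" for j
    using the_inv_f_f[OF inj', of j] .
  let ?u = "\<lambda>v. x (the_inv (\<lambda>i. b (r i)) v)"
  have "(\<Sum>v\<in>b ` {..<d}. ?u v *\<^sub>R v) = 0"
    unfolding im[symmetric] using sum inj' by (simp add: sum.reindex inv)
  moreover have "b (r i) \<in> b ` {..<d}" using im by auto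
  ultimately have "?u (b (r i)) = 0"
    using independentD[OF ind, of "b ` {..<d}" ?u] by blast
  then show "x i = 0" by (simp add: inv)
qed

text \<open>
  Stated for every Borel set \<open>T\<close> rather than for \<open>P\<close>, so that a piece of \<open>P\<close> can be measured in the
  frame that suits it best. The type \<open>'d\<close> provides the space \<open>real ^ 'd\<close> in which the transition
  between the two frames becomes a matrix.
\<close>
theorem emeasure_frame_unique:
  fixes L P T :: "'a::euclidean_space set"
  assumes F: "lattice_frame L P p b" and F': "lattice_frame L P p' b'"
    and d: "nat (aff_dim P) = CARD('d::{finite,wellorder})" and T: "T \<in> sets borel"
  defines "M \<equiv> \<Pi>\<^sub>M i\<in>{..<nat (aff_dim P)}. lborel :: real measure"
  shows "emeasure M {x \<in> space M. p + (\<Sum>i<nat (aff_dim P). x i *\<^sub>R b i) \<in> T} =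
    emeasure M {x \<in> space M. p' + (\<Sum>i<nat (aff_dim P). x i *\<^sub>R b' i) \<in> T}"
proof -
  define d' where "d' = nat (aff_dim P)"
  have "card (UNIV :: 'd set) = card {..<d'}"
    unfolding d'_def d by simp
  then obtain r :: "'d \<Rightarrow> nat" where r: "bij_betw r UNIV {..<d'}"
    using finite_same_card_bij[OF finite finite_lessThan] by blast
  have re: "(\<Sum>i<d'. f i) = (\<Sum>i\<in>UNIV. f (r i))" for f :: "nat \<Rightarrow> 'a"
    using sum.reindex_bij_betw[OF r, of f] by simp
  let ?f = "\<lambda>x. (\<chi> i. x (r i)) :: (real, 'd) vec"
  have meas: "?f \<in> measurable M borel"
    unfolding M_def d'_def[symmetric] using r by (rule measurable_vec_of_coordinates)
  define chart where "chart q \<gamma> z = q + (\<Sum>i\<in>UNIV. z $ i *\<^sub>R \<gamma> (r i))" for q :: 'a and \<gamma> and z :: "(real, 'd) vec"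
  have chart_borel: "chart q \<gamma> -` T \<in> sets borel" for q \<gamma>
  proof -
    have "chart q \<gamma> \<in> borel_measurable borel"
      unfolding chart_def by (intro borel_measurable_continuous_onI continuous_intros)
    then show ?thesis using T by (rule measurable_sets_borel)
  qed
  have to_vec: "emeasure M {x \<in> space M. q + (\<Sum>i<d'. x i *\<^sub>R \<gamma> i) \<in> T} = emeasure lborel (chart q \<gamma> -` T)" for q \<gamma>
  proof -
    have "emeasure lborel (chart q \<gamma> -` T) = emeasure (distr M borel ?f) (chart q \<gamma> -` T)"
      unfolding M_def d'_def[symmetric] lborel_vec_eq_distr_PiM[OF r] ..
    also have "\<dots> = emeasure M (?f -` (chart q \<gamma> -` T) \<inter> space M)"
      by (rule emeasure_distr[OF meas]) (simp add: chart_borel)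
    also have "?f -` (chart q \<gamma> -` T) \<inter> space M = {x \<in> space M. q + (\<Sum>i<d'. x i *\<^sub>R \<gamma> i) \<in> T}"
      by (auto simp: chart_def re)
    finally show ?thesis ..
  qed
  have lat: "range (\<lambda>c :: 'd \<Rightarrow> int. q + (\<Sum>i\<in>UNIV. of_int (c i) *\<^sub>R \<gamma> (r i))) = L \<inter> affine hull P"
    if "lattice_frame L P q \<gamma>" for q \<gamma>
  proof -
    have "L \<inter> affine hull P = {q + (\<Sum>i<d'. of_int (c i) *\<^sub>R \<gamma> i) |c :: nat \<Rightarrow> int. c \<in> UNIV}"
      using that by (auto simp: lattice_frame_def Let_def d'_def)
    also have "\<dots> = {q + (\<Sum>i\<in>UNIV. of_int (c (r i)) *\<^sub>R \<gamma> (r i)) |c :: nat \<Rightarrow> int. c \<in> UNIV}"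
      by (simp only: re)
    also have "\<dots> = range (\<lambda>c :: 'd \<Rightarrow> int. q + (\<Sum>i\<in>UNIV. of_int (c i) *\<^sub>R \<gamma> (r i)))" (is "?X = ?Y")
    proof (intro equalityI subsetI)
      fix x assume "x \<in> ?Y"
      then obtain c :: "'d \<Rightarrow> int" where c: "x = q + (\<Sum>i\<in>UNIV. of_int (c i) *\<^sub>R \<gamma> (r i))" by auto
      have "x = q + (\<Sum>i\<in>UNIV. of_int (c (the_inv r (r i))) *\<^sub>R \<gamma> (r i))"
        using r by (simp add: c bij_betw_def the_inv_f_f)
      then show "x \<in> ?X" by (intro CollectI exI[of _ "\<lambda>k. c (the_inv r k)"]) simp
    qed auto
    finally show ?thesis ..
  qed
  have ind: "x = (\<lambda>_. 0)"
    if "lattice_frame L P q \<gamma>" "(\<Sum>i\<in>UNIV. x i *\<^sub>R \<gamma> (r i)) = 0" for q \<gamma> x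
    using that independent_family_sum_zero[OF r] by (auto simp: lattice_frame_def Let_def d'_def)
  obtain c :: "(real, 'd) vec" and A B where AB: "A ** B = mat 1" "\<And>i j. A $ i $ j \<in> \<int>" "\<And>i j. B $ i $ j \<in> \<int>"
    and ch: "\<And>x. p' + (\<Sum>i\<in>UNIV. x $ i *\<^sub>R b' (r i)) = p + (\<Sum>i\<in>UNIV. (c + A *v x) $ i *\<^sub>R b (r i))"
    by (rule unimodular_change_of_frame[OF ind[OF F] ind[OF F'] trans[OF lat[OF F] lat[OF F', symmetric]]],
        assumption, assumption, rule that)
  have "chart p' b' -` T = (\<lambda>x. c + A *v x) -` (chart p b -` T)"
    by (simp add: chart_def ch vimage_def)
  then have "emeasure lborel (chart p' b' -` T) = emeasure lborel (chart p b -` T)"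
    using emeasure_lborel_unimodular[OF AB chart_borel[of p b], of c] by simp
  then show ?thesis
    unfolding d'_def[symmetric] to_vec by simp
qed

section \<open>Bipolarity and lattice polytopes\<close>

lemma lattice_polytope_convex_hull:
  assumes "finite W" "W \<subseteq> L"
  shows "lattice_polytope L (convex hull W)"
  using assms extreme_point_of_convex_hull unfolding lattice_polytope_def polytope_def by blast

text \<open>
  The orthogonal projection of \<open>a\<close> represents the restriction of the functional \<open>v \<mapsto> a \<bullet> v\<close>.
\<close>
lemma riesz_in_subspace:
  fixes V :: "'a::euclidean_space set"
  assumes "subspace V"
  obtains y where "y \<in> V" "\<And>v. v \<in> V \<Longrightarrow> y \<bullet> v = a \<bullet> v"
proof -
  obtain y z where y: "y \<in> span V" and z: "\<And>w. w \<in> span V \<Longrightarrow> orthogonal z w" and a: "a = y + z"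
    using orthogonal_subspace_decomp_exists[of V a] by metis
  have V: "span V = V" using assms by simp
  show thesis
    by (rule that[of y]) (use y z a V in \<open>auto simp: orthogonal_def inner_add_left\<close>)
qed

text \<open>
  Since \<open>N\<close> is finite, \<open>P\<close> contains a neighbourhood of \<open>0\<close> in \<open>V\<close>. As \<open>P\<close> is the polar of the
  convex hull of \<open>N\<close>, the third claim is the bipolar theorem: a point of \<open>V\<close> outside the convex hull
  is separated from it by a hyperplane, which does not meet \<open>0\<close> because \<open>0\<close> lies in the hull.
\<close>
lemma
  fixes V :: "'a::euclidean_space set"
  assumes V: "subspace V" and N: "finite N" "N \<subseteq> V" and zero: "0 \<in> convex hull N"
  defines "P \<equiv> {y \<in> V. \<forall>q\<in>N. -1 \<le> q \<bullet> y}"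
  shows span_halfspaces: "span P = V"
    and zero_in_rel_interior_halfspaces: "0 \<in> rel_interior P"
    and polar_polytope_halfspaces: "polar_polytope P = convex hull N"
proof -
  define U where "U = (\<Inter>q\<in>N. {y. -1 < q \<bullet> y})"
  have "open U"
    unfolding U_def using N(1) by (intro open_INT ballI) (auto intro!: open_halfspace_gt)
  moreover have "0 \<in> U" by (simp add: U_def)
  ultimately obtain e where e: "e > 0" "ball 0 e \<subseteq> U" by (meson open_contains_ball)
  have ball: "y \<in> P" if "y \<in> V" "y \<in> ball 0 e" for y
    using that e(2) by (force simp: P_def U_def)
  have "0 \<in> P" using V by (simp add: P_def subspace_0)
  have PV: "P \<subseteq> V" by (auto simp: P_def)
  have spanP: "span P = V"
  proof
    show "span P \<subseteq> V" using PV V by (metis span_minimal)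
    show "V \<subseteq> span P"
    proof
      fix y assume y: "y \<in> V"
      define t where "t = e / (2 * (norm y + 1))"
      have t: "t > 0" using e by (simp add: t_def add_nonneg_pos)
      have "norm (t *\<^sub>R y) = e * (norm y / (2 * (norm y + 1)))" using e by (simp add: t_def)
      also have "\<dots> < e * 1"
        using e(1) by (intro mult_strict_left_mono) (auto simp: divide_simps add_nonneg_pos)
      finally have "t *\<^sub>R y \<in> P"
        using y V by (intro ball) (auto simp: subspace_scale)
      then have "(1 / t) *\<^sub>R t *\<^sub>R y \<in> span P" by (intro span_mul span_base)
      then show "y \<in> span P" using t by simp
    qed
  qed
  show "span P = V" by (rule spanP)
  have "affine hull P \<subseteq> V"
    using PV V by (simp add: hull_minimal subspace_imp_affine)
  then show "0 \<in> rel_interior P"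
    unfolding mem_rel_interior_ball using \<open>0 \<in> P\<close> e(1) ball by blast
  show "polar_polytope P = convex hull N"
  proof
    have "convex hull N \<subseteq> V"
      using N V by (simp add: hull_minimal subspace_imp_convex)
    moreover have "convex hull N \<subseteq> {x. -1 \<le> v \<bullet> x}" if "v \<in> P" for v
    proof (rule hull_minimal)
      show "N \<subseteq> {x. -1 \<le> v \<bullet> x}" using that by (auto simp: P_def inner_commute)
      show "convex {x. -1 \<le> v \<bullet> x}" by (rule convex_halfspace_ge)
    qed
    ultimately have "-1 \<le> x \<bullet> v" "x \<in> V" if "v \<in> P" "x \<in> convex hull N" for v x
      using that by (fastforce simp: inner_commute)+
    then show "convex hull N \<subseteq> polar_polytope P"
      unfolding polar_polytope_def spanP using \<open>0 \<in> P\<close> by blast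
  next
    show "polar_polytope P \<subseteq> convex hull N"
    proof (rule ccontr)
      assume "\<not> polar_polytope P \<subseteq> convex hull N"
      then obtain x where x: "x \<in> V" "\<And>v. v \<in> P \<Longrightarrow> -1 \<le> x \<bullet> v" "x \<notin> convex hull N"
        by (auto simp: polar_polytope_def spanP)
      have "closed (convex hull N)"
        using N(1) by (simp add: compact_imp_closed compact_convex_hull finite_imp_compact)
      then obtain a b where a: "a \<bullet> x < b" "\<And>c. c \<in> convex hull N \<Longrightarrow> b < a \<bullet> c"
        using separating_hyperplane_closed_point[OF convex_convex_hull _ x(3)] by blast
      have b: "b < 0" using a(2)[OF zero] by simp
      obtain y where y: "y \<in> V" "\<And>v. v \<in> V \<Longrightarrow> y \<bullet> v = a \<bullet> v"
        using riesz_in_subspace[OF V] by metis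
      \<comment> \<open>The separating functional, represented inside \<open>V\<close> and scaled to the level \<open>-1\<close>, is a
        point of \<open>P\<close> that \<open>x\<close> violates.\<close>
      define z where "z = (1 / - b) *\<^sub>R y"
      have "z \<in> P"
        unfolding P_def
      proof (intro CollectI conjI ballI)
        show "z \<in> V" using V y(1) unfolding z_def by (rule subspace_scale)
        fix q assume q: "q \<in> N"
        then have "b < y \<bullet> q" using a(2)[of q] y(2)[of q] N by (auto simp: hull_inc)
        then show "-1 \<le> q \<bullet> z" using b by (simp add: z_def inner_commute field_simps)
      qed
      moreover have "x \<bullet> z < -1"
        using a(1) y(2)[OF x(1)] b by (simp add: z_def inner_commute field_simps)
      ultimately show False using x(2) by fastforce
    qed
  qed
qed

section \<open>Convex and affine combinations of finite families\<close>

lemma convex_hull_range: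
  fixes v :: "'i::finite \<Rightarrow> 'a::real_vector"
  shows "convex hull (range v) =
    {\<Sum>i\<in>UNIV. g i *\<^sub>R v i |g. (\<forall>i. 0 \<le> g i) \<and> sum g UNIV = 1}" (is "_ = ?C")
proof
  show "convex hull (range v) \<subseteq> ?C"
  proof (rule hull_minimal)
    show "range v \<subseteq> ?C"
    proof safe
      fix j
      show "\<exists>g. v j = (\<Sum>i\<in>UNIV. g i *\<^sub>R v i) \<and> (\<forall>i. 0 \<le> g i) \<and> sum g UNIV = 1"
        by (rule exI[of _ "\<lambda>i. if i = j then 1 else 0"])
          (simp add: if_distrib[of "\<lambda>x. x *\<^sub>R _"] cong: if_cong)
    qed
    show "convex ?C"
    proof (rule convexI)
      fix x y and s t :: real
      assume "x \<in> ?C" "y \<in> ?C" and st: "0 \<le> s" "0 \<le> t" "s + t = 1"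
      then obtain g h where "x = (\<Sum>i\<in>UNIV. g i *\<^sub>R v i)" "\<forall>i. 0 \<le> g i" "sum g UNIV = 1"
        "y = (\<Sum>i\<in>UNIV. h i *\<^sub>R v i)" "\<forall>i. 0 \<le> h i" "sum h UNIV = 1" by auto
      then show "s *\<^sub>R x + t *\<^sub>R y \<in> ?C"
        using st
        by (intro CollectI exI[of _ "\<lambda>i. s * g i + t * h i"])
          (simp add: scaleR_sum_right scaleR_add_left sum.distrib flip: sum_distrib_left)
    qed
  qed
  show "?C \<subseteq> convex hull (range v)"
    by (auto intro!: convex_sum simp: hull_inc)
qed

lemma affine_hull_range:
  fixes v :: "'i::finite \<Rightarrow> 'a::real_vector"
  shows "affine hull (range v) = {\<Sum>i\<in>UNIV. g i *\<^sub>R v i |g. sum g UNIV = 1}" (is "_ = ?C")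
proof
  show "affine hull (range v) \<subseteq> ?C"
  proof (rule hull_minimal)
    show "range v \<subseteq> ?C"
    proof safe
      fix j
      show "\<exists>g. v j = (\<Sum>i\<in>UNIV. g i *\<^sub>R v i) \<and> sum g UNIV = 1"
        by (rule exI[of _ "\<lambda>i. if i = j then 1 else 0"])
          (simp add: if_distrib[of "\<lambda>x. x *\<^sub>R _"] cong: if_cong)
    qed
    show "affine ?C"
      unfolding affine_def
    proof (intro ballI allI impI)
      fix x y and s t :: real
      assume "x \<in> ?C" "y \<in> ?C" and st: "s + t = 1"
      then obtain g h where "x = (\<Sum>i\<in>UNIV. g i *\<^sub>R v i)" "sum g UNIV = 1"
        "y = (\<Sum>i\<in>UNIV. h i *\<^sub>R v i)" "sum h UNIV = 1" by auto
      then show "s *\<^sub>R x + t *\<^sub>R y \<in> ?C"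
        using st
        by (intro CollectI exI[of _ "\<lambda>i. s * g i + t * h i"])
          (simp add: scaleR_sum_right scaleR_add_left sum.distrib flip: sum_distrib_left)
    qed
  qed
  show "?C \<subseteq> affine hull (range v)"
  proof safe
    fix g :: "'i \<Rightarrow> real" assume g: "sum g UNIV = 1"
    obtain j :: 'i where "True" by simp
    have "(\<Sum>i\<in>UNIV. g i *\<^sub>R v i) = v j + (\<Sum>i\<in>UNIV. g i *\<^sub>R (- v j + v i))"
      using g by (simp add: scaleR_diff_right sum_subtractf flip: scaleR_sum_left)
    also have "\<dots> \<in> affine hull (range v)"
    proof (subst affine_hull_span_gen[of "v j"])
      show "v j \<in> affine hull (range v)" by (simp add: hull_inc)
      show "v j + (\<Sum>i\<in>UNIV. g i *\<^sub>R (- v j + v i)) \<in>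
          (+) (v j) ` span ((+) (- v j) ` range v)"
        by (rule imageI, rule span_sum, rule span_mul, rule span_base) auto
    qed
    finally show "(\<Sum>i\<in>UNIV. g i *\<^sub>R v i) \<in> affine hull (range v)" .
  qed
qed

lemma
  fixes b :: "nat \<Rightarrow> 'a::real_vector"
  assumes zero: "\<And>x. (\<Sum>i<d. x i *\<^sub>R b i) = 0 \<Longrightarrow> \<forall>i<d. x i = 0"
  shows inj_on_independent_family: "inj_on b {..<d}"
    and independent_image_family: "independent (b ` {..<d})"
proof -
  show inj: "inj_on b {..<d}"
  proof (rule inj_onI, rule ccontr)
    fix i k assume ik: "i \<in> {..<d}" "k \<in> {..<d}" "b i = b k" "i \<noteq> k"
    have "(\<Sum>l<d. ((if l = i then 1 else 0) - (if l = k then 1 else 0)) *\<^sub>R b l) = b i - b k"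
      using ik by (simp add: scaleR_diff_left sum_subtractf if_distrib[of "\<lambda>x. x *\<^sub>R _"] cong: if_cong)
    then show False using zero[of "\<lambda>l. (if l = i then 1 else 0) - (if l = k then 1 else 0)"] ik by auto
  qed
  show "independent (b ` {..<d})"
  proof (rule independent_if_scalars_zero)
    fix f v assume "(\<Sum>v\<in>b ` {..<d}. f v *\<^sub>R v) = 0" "v \<in> b ` {..<d}"
    then show "f v = 0" using zero[of "\<lambda>i. f (b i)"] inj by (auto simp: sum.reindex)
  qed simp
qed

lemma span_family:
  fixes b :: "nat \<Rightarrow> 'a::real_vector"
  shows "span (b ` {..<d}) = range (\<lambda>x. \<Sum>i<d. x i *\<^sub>R b i)"
proof
  have "subspace (range (\<lambda>x. \<Sum>i<d. x i *\<^sub>R b i))"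
  proof (rule subspaceI)
    show "0 \<in> range (\<lambda>x. \<Sum>i<d. x i *\<^sub>R b i)"
      by (rule image_eqI[of _ _ "\<lambda>_. 0"]) auto
    fix u v and c :: real
    assume "u \<in> range (\<lambda>x. \<Sum>i<d. x i *\<^sub>R b i)"
    then obtain x where x: "u = (\<Sum>i<d. x i *\<^sub>R b i)" by auto
    show "c *\<^sub>R u \<in> range (\<lambda>x. \<Sum>i<d. x i *\<^sub>R b i)"
      by (rule image_eqI[of _ _ "\<lambda>i. c * x i"]) (simp_all add: x scaleR_sum_right)
    assume "v \<in> range (\<lambda>x. \<Sum>i<d. x i *\<^sub>R b i)"
    then obtain y where y: "v = (\<Sum>i<d. y i *\<^sub>R b i)" by auto
    show "u + v \<in> range (\<lambda>x. \<Sum>i<d. x i *\<^sub>R b i)"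
      by (rule image_eqI[of _ _ "\<lambda>i. x i + y i"]) (simp_all add: x y scaleR_add_left sum.distrib)
  qed
  moreover have "b k \<in> range (\<lambda>x. \<Sum>i<d. x i *\<^sub>R b i)" if "k < d" for k
    using that by (intro image_eqI[of _ _ "\<lambda>i. if i = k then 1 else 0"])
      (simp_all add: if_distrib[of "\<lambda>x. x *\<^sub>R _"] cong: if_cong)
  ultimately show "span (b ` {..<d}) \<subseteq> range (\<lambda>x. \<Sum>i<d. x i *\<^sub>R b i)"
    by (intro span_minimal) auto
  show "range (\<lambda>x. \<Sum>i<d. x i *\<^sub>R b i) \<subseteq> span (b ` {..<d})"
  proof safe
    fix x :: "nat \<Rightarrow> real"
    show "(\<Sum>i<d. x i *\<^sub>R b i) \<in> span (b ` {..<d})"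
      by (rule span_sum, rule span_mul, rule span_base) auto
  qed
qed

section \<open>Points of the polytope as weights on its vertices\<close>

text \<open>Each multiplication by the shift matrix moves the single entry of a row by one column.\<close>
lemma matrix_power_shift_matrix:
  "matrix_power shift_matrix m $ i $ j = (if j = i + of_nat m then 1 else 0)"
proof (induction m arbitrary: i)
  case 0
  show ?case by (simp add: matrix_power_def mat_def)
next
  case (Suc m)
  have "matrix_power shift_matrix (Suc m) $ i $ j =
      (\<Sum>k\<in>UNIV. shift_matrix $ i $ k * matrix_power shift_matrix m $ k $ j)"
    by (simp add: matrix_power_def matrix_matrix_mult_def)
  also have "\<dots> = (\<Sum>k\<in>UNIV. if k = i + 1 then matrix_power shift_matrix m $ k $ j else 0)"
    by (rule sum.cong) (auto simp: shift_matrix_def)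
  also have "\<dots> = matrix_power shift_matrix m $ (i + 1) $ j" by simp
  finally show ?case by (simp add: Suc.IH add.assoc)
qed

lemma of_nat_nat_to_int_mod_ring:
  "of_nat (nat (to_int_mod_ring k)) = (k :: 'n::nontriv mod_ring)"
proof -
  have "to_int_mod_ring k \<in> {0..<int CARD('n)}"
    using range_to_int_mod_ring by (metis rangeI)
  then show ?thesis by (simp add: of_nat_of_int_mod_ring)
qed

lemma Q_matrix_Inl: "Q_matrix $ Inl i $ (k, j) = (if j = i then 1 else 0)"
  by (auto simp: Q_matrix_def mat_def)

lemma Q_matrix_Inr: "Q_matrix $ Inr i $ (k, j) = (if j - k = i then 1 else 0)"
  by (auto simp: Q_matrix_def matrix_power_shift_matrix of_nat_nat_to_int_mod_ring)

definition vertex_comb ::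
  "('n::nontriv mod_ring + 'n mod_ring \<Rightarrow> real) \<Rightarrow> real ^ ('n mod_ring \<times> 'n mod_ring)" where
  "vertex_comb g = (\<Sum>r\<in>UNIV. g r *\<^sub>R Q_matrix $ r)"

lemma sum_UNIV_Plus:
  "sum g (UNIV :: ('a::finite + 'b::finite) set) = (\<Sum>i\<in>UNIV. g (Inl i)) + (\<Sum>i\<in>UNIV. g (Inr i))"
  using sum.Plus[of UNIV UNIV g] by (simp add: comp_def)

lemma vertex_comb_nth: "vertex_comb g $ (k, j) = g (Inl j) + g (Inr (j - k))"
proof -
  have "vertex_comb g $ (k, j) = (\<Sum>r\<in>UNIV. g r * Q_matrix $ r $ (k, j))"
    by (simp add: vertex_comb_def)
  also have "\<dots> = (\<Sum>i\<in>UNIV. if j = i then g (Inl i) else 0) + (\<Sum>i\<in>UNIV. if j - k = i then g (Inr i) else 0)"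
    unfolding sum_UNIV_Plus Q_matrix_Inl Q_matrix_Inr
    by (intro arg_cong2[of _ _ _ _ "(+)"] sum.cong) auto
  finally show ?thesis by simp
qed

lemma vertex_comb_nth_diff: "vertex_comb g $ (a - b, a) = g (Inl a) + g (Inr b)"
  by (simp add: vertex_comb_nth)

lemma vertex_comb_add: "vertex_comb (\<lambda>r. g r + h r) = vertex_comb g + vertex_comb h"
  by (simp add: vertex_comb_def scaleR_add_left sum.distrib)

lemma vertex_comb_scaleR: "vertex_comb (\<lambda>r. c * g r) = c *\<^sub>R vertex_comb g"
  by (simp add: vertex_comb_def scaleR_sum_right)

lemma vertex_comb_diff: "vertex_comb (\<lambda>r. g r - h r) = vertex_comb g - vertex_comb h"
  by (simp add: vertex_comb_def scaleR_diff_left sum_subtractf)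

text \<open>
  All upper vertices together have the same sum as all lower vertices. Adding a multiple of this
  relation changes the weights, but not the point.
\<close>
definition shift_weights ::
  "real \<Rightarrow> ('a + 'b \<Rightarrow> real) \<Rightarrow> 'a + 'b \<Rightarrow> real" where
  "shift_weights c g r = (case r of Inl i \<Rightarrow> g r + c | Inr i \<Rightarrow> g r - c)"

lemma shift_weights_simps [simp]:
  "shift_weights c g (Inl i) = g (Inl i) + c"
  "shift_weights c g (Inr j) = g (Inr j) - c"
  by (simp_all add: shift_weights_def)

lemma vertex_comb_shift_weights [simp]: "vertex_comb (shift_weights c g) = vertex_comb g"
  by (simp add: vec_eq_iff split_paired_all vertex_comb_nth)

lemma sum_shift_weights [simp]:
  fixes g :: "'a::finite + 'a \<Rightarrow> real"
  shows "sum (shift_weights c g) UNIV = sum g UNIV"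
  by (simp add: sum_UNIV_Plus sum.distrib sum_subtractf)

text \<open>
  The coordinates of the point are all sums \<open>g (Inl a) + g (Inr b)\<close>, and these determine \<open>g\<close> up to one
  constant.
\<close>
lemma vertex_comb_eqD:
  assumes "vertex_comb g = vertex_comb h"
  obtains c where "g = shift_weights c h"
proof -
  have eq: "g (Inl a) + g (Inr b) = h (Inl a) + h (Inr b)" for a b
    using assms by (metis vertex_comb_nth_diff)
  have "g r = shift_weights (g (Inl 0) - h (Inl 0)) h r" for r
  proof (cases r)
    case (Inl a)
    then show ?thesis using eq[of a 0] eq[of 0 0] by simp
  next
    case (Inr b)
    then show ?thesis using eq[of 0 b] by simp
  qed
  then show thesis by (intro that) blast
qed

lemma vertex_comb_inject:
  assumes "vertex_comb g = vertex_comb h" "g (Inr j) = h (Inr j)"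
  shows "g = h"
proof -
  obtain c where c: "g = shift_weights c h" using vertex_comb_eqD[OF assms(1)] .
  then have "c = 0" using assms(2) by simp
  have "shift_weights 0 h r = h r" for r by (cases r) auto
  then show ?thesis using c \<open>c = 0\<close> by auto
qed

text \<open>
  Setting one lower weight to zero makes the upper weights coordinates of the point, and then the
  other lower weights are differences of coordinates.
\<close>
lemma vertex_comb_in_lattice_iff:
  assumes "g (Inr j) = 0"
  shows "vertex_comb g \<in> integer_lattice \<longleftrightarrow> (\<forall>r. g r \<in> \<int>)"
proof
  assume *: "vertex_comb g \<in> integer_lattice"
  have sum: "g (Inl a) + g (Inr b) \<in> \<int>" for a b
    using * unfolding integer_lattice_def vertex_comb_nth_diff[symmetric] by blast
  have l: "g (Inl a) \<in> \<int>" for a using sum[of a j] assms by simp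
  show "\<forall>r. g r \<in> \<int>"
  proof
    fix r
    show "g r \<in> \<int>"
    proof (cases r)
      case (Inr b)
      then show ?thesis using Ints_diff[OF sum[of 0 b] l[of 0]] by simp
    qed (simp add: l)
  qed
next
  assume "\<forall>r. g r \<in> \<int>"
  then show "vertex_comb g \<in> integer_lattice"
    by (simp add: integer_lattice_def split_paired_all vertex_comb_nth)
qed

lemma rows_eq_range: "rows A = range (\<lambda>r. A $ r)"
  by (auto simp: rows_def row_def)

lemma Q_polytope_eq:
  "Q_polytope = {vertex_comb g |g. (\<forall>r. 0 \<le> g r) \<and> sum g UNIV = 1}"
  and affine_hull_Q_polytope: "affine hull Q_polytope = {vertex_comb g |g. sum g UNIV = 1}"
proof -
  show "Q_polytope = {vertex_comb g |g. (\<forall>r. 0 \<le> g r) \<and> sum g UNIV = 1}"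
    unfolding Q_polytope_def rows_eq_range vertex_comb_def by (rule convex_hull_range)
  show "affine hull Q_polytope = {vertex_comb g |g. sum g UNIV = 1}"
    unfolding Q_polytope_def rows_eq_range vertex_comb_def affine_hull_convex_hull by (rule affine_hull_range)
qed

text \<open>
  The smallest coordinate is the sum of the smallest upper and the smallest lower weight. If it is
  nonnegative, moving the smallest lower weight to the upper side makes all weights nonnegative.
\<close>
lemma Q_polytope_halfspaces:
  "x \<in> Q_polytope \<longleftrightarrow> x \<in> affine hull Q_polytope \<and> (\<forall>i. 0 \<le> x $ i)"
proof
  assume "x \<in> Q_polytope"
  then show "x \<in> affine hull Q_polytope \<and> (\<forall>i. 0 \<le> x $ i)"
    by (auto simp: hull_inc) (auto simp: Q_polytope_eq vertex_comb_nth)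
next
  assume *: "x \<in> affine hull Q_polytope \<and> (\<forall>i. 0 \<le> x $ i)"
  then obtain g where g: "x = vertex_comb g" "sum g UNIV = 1" by (auto simp: affine_hull_Q_polytope)
  define c where "c = Min (range (\<lambda>b. g (Inr b)))"
  have c: "c \<le> g (Inr b)" for b by (simp add: c_def)
  have "c \<in> range (\<lambda>b. g (Inr b))" unfolding c_def by (rule Min_in) auto
  then obtain b0 where b0: "c = g (Inr b0)" by auto
  have "0 \<le> g (Inl a) + c" for a
    using * unfolding b0 g(1) vertex_comb_nth_diff[symmetric] by blast
  then have "0 \<le> shift_weights c g r" for r
    using c by (cases r) auto
  then show "x \<in> Q_polytope"
    using g unfolding Q_polytope_eq by (intro CollectI exI[of _ "shift_weights c g"]) auto
qed

section \<open>The Gorenstein property\<close>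

definition zero_sum_space :: "(real ^ ('n::nontriv mod_ring \<times> 'n mod_ring)) set" where
  "zero_sum_space = {vertex_comb g |g. sum g UNIV = 0}"

lemma subspace_zero_sum_space: "subspace zero_sum_space"
  unfolding zero_sum_space_def
proof (rule subspaceI; safe)
  show "\<exists>g. 0 = vertex_comb g \<and> sum g UNIV = 0"
    by (rule exI[of _ "\<lambda>_. 0"]) (simp add: vertex_comb_def)
  fix g h :: "'a mod_ring + 'a mod_ring \<Rightarrow> real" and c :: real
  assume g: "sum g UNIV = 0"
  show "\<exists>f. c *\<^sub>R vertex_comb g = vertex_comb f \<and> sum f UNIV = 0"
    using g by (intro exI[of _ "\<lambda>r. c * g r"]) (simp add: vertex_comb_scaleR flip: sum_distrib_left)
  assume h: "sum h UNIV = 0"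
  show "\<exists>f. vertex_comb g + vertex_comb h = vertex_comb f \<and> sum f UNIV = 0"
    using g h by (intro exI[of _ "\<lambda>r. g r + h r"]) (simp add: vertex_comb_add sum.distrib)
qed

text \<open>Every weight is counted in exactly \<open>n\<close> coordinates.\<close>
lemma sum_zero_sum_space:
  fixes v :: "real ^ ('n::nontriv mod_ring \<times> 'n mod_ring)"
  assumes "v \<in> zero_sum_space"
  shows "(\<Sum>i\<in>UNIV. v $ i) = 0"
proof -
  obtain g where g: "v = vertex_comb g" "sum g UNIV = 0"
    using assms by (auto simp: zero_sum_space_def)
  have "(\<Sum>i\<in>UNIV. v $ i) = (\<Sum>k\<in>UNIV. \<Sum>j\<in>UNIV. v $ (k, j))"
    by (simp add: sum.cartesian_product split_def)
  also have "\<dots> = (\<Sum>k\<in>UNIV. (\<Sum>j\<in>UNIV. g (Inl j)) + (\<Sum>j\<in>UNIV. g (Inr (j - k))))"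
    by (simp add: g(1) vertex_comb_nth sum.distrib)
  also have "\<dots> = (\<Sum>k\<in>(UNIV :: 'n mod_ring set). sum g UNIV)"
  proof (rule sum.cong[OF refl])
    fix k :: "'n mod_ring"
    have "bij (\<lambda>j. j - k)"
      by (rule bij_betw_byWitness[where f' = "\<lambda>j. j + k"]) auto
    then show "(\<Sum>j\<in>UNIV. g (Inl j)) + (\<Sum>j\<in>UNIV. g (Inr (j - k))) = sum g UNIV"
      using sum.reindex_bij_betw[of "\<lambda>j. j - k" UNIV UNIV "\<lambda>j. g (Inr j)"]
      by (simp add: sum_UNIV_Plus)
  qed
  finally show ?thesis by (simp add: g(2))
qed

definition all_ones :: "real ^ 'm" where
  "all_ones = (\<chi> i. 1)"

lemma all_ones_eq_vertex_comb:
  "all_ones = vertex_comb (\<lambda>r. if isl r then 1 else 0)"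
  by (simp add: all_ones_def vec_eq_iff split_paired_all vertex_comb_nth)

lemma shifted_dilate_eq_halfspaces:
  "(\<lambda>x. real CARD('n) *\<^sub>R x - all_ones) ` Q_polytope =
    {y \<in> zero_sum_space. \<forall>i. -1 \<le> (y :: real ^ ('n::nontriv mod_ring \<times> 'n mod_ring)) $ i}"
  (is "?L = ?R")
proof (intro equalityI subsetI)
  let ?n = "real CARD('n)"
  let ?h = "\<lambda>r :: 'n mod_ring + 'n mod_ring. if isl r then 1 else 0 :: real"
  have sum_h: "sum ?h UNIV = ?n" by (simp add: sum_UNIV_Plus)
  {
    fix y assume "y \<in> ?L"
    then obtain x where x: "x \<in> Q_polytope" and y: "y = ?n *\<^sub>R x - all_ones" by auto
    obtain g where g: "x = vertex_comb g" "sum g UNIV = 1" using x by (auto simp: Q_polytope_eq)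
    have "y = vertex_comb (\<lambda>r. ?n * g r - ?h r)"
      by (simp add: y g(1) all_ones_eq_vertex_comb vertex_comb_diff vertex_comb_scaleR)
    moreover have "(\<Sum>r\<in>UNIV. ?n * g r - ?h r) = 0"
      by (simp add: sum_subtractf sum_h g(2) flip: sum_distrib_left)
    moreover have "0 \<le> x $ i" for i
      using x unfolding Q_polytope_halfspaces by blast
    then have "-1 \<le> y $ i" for i by (simp add: y all_ones_def)
    ultimately show "y \<in> ?R" by (auto simp: zero_sum_space_def)
  next
    fix y assume y: "y \<in> ?R"
    then obtain g where g: "y = vertex_comb g" "sum g UNIV = 0" by (auto simp: zero_sum_space_def)
    define x where "x = vertex_comb (\<lambda>r. (1 / ?n) * (g r + ?h r))"
    have x: "x = (1 / ?n) *\<^sub>R (y + all_ones)"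
      unfolding x_def g(1) all_ones_eq_vertex_comb vertex_comb_scaleR vertex_comb_add ..
    have "(\<Sum>r\<in>UNIV. (1 / ?n) * (g r + ?h r)) = 1"
      by (simp only: sum_distrib_left[symmetric] sum.distrib g(2) sum_h) simp
    then have "x \<in> affine hull Q_polytope"
      unfolding x_def affine_hull_Q_polytope by blast
    moreover have "-1 \<le> y $ i" for i using y by blast
    then have "0 \<le> y $ i + 1" for i by (smt (verit))
    then have "0 \<le> x $ i" for i by (simp add: x all_ones_def)
    ultimately have "x \<in> Q_polytope" by (simp add: Q_polytope_halfspaces)
    moreover have "y = ?n *\<^sub>R x - all_ones" by (simp add: x)
    ultimately show "y \<in> ?L" by blast
  }
qed

text \<open>
  The interior lattice point of the \<open>n\<close>-th dilate is the all-ones vector, the sum of the upper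
  vertices.
\<close>
theorem Gorenstein_Q_polytope:
  "Gorenstein_polytope integer_lattice
    (Q_polytope :: (real ^ ('n::nontriv mod_ring \<times> 'n mod_ring)) set) CARD('n)"
proof -
  let ?n = "real CARD('n)"
  let ?Q = "Q_polytope :: (real ^ ('n mod_ring \<times> 'n mod_ring)) set"
  let ?V = "zero_sum_space :: (real ^ ('n mod_ring \<times> 'n mod_ring)) set"
  let ?L = "integer_lattice :: (real ^ ('n mod_ring \<times> 'n mod_ring)) set"
  define P where "P = (\<lambda>x. ?n *\<^sub>R x - all_ones) ` ?Q"
  \<comment> \<open>\<open>q i\<close> represents the coordinate \<open>i\<close> on the zero-sum space.\<close>
  have "\<exists>q. q \<in> ?V \<and> (\<forall>v\<in>?V. q \<bullet> v = v $ i)" for i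
    using riesz_in_subspace[OF subspace_zero_sum_space, of "axis i 1"]
    by (metis inner_axis' mult_1 real_inner_1_left)
  then obtain q where qV: "\<And>i. q i \<in> ?V" and q: "\<And>i v. v \<in> ?V \<Longrightarrow> q i \<bullet> v = v $ i"
    by metis
  \<comment> \<open>The sum of the \<open>q i\<close> represents the sum of all coordinates, which vanishes there.\<close>
  have sum_q: "(\<Sum>i\<in>UNIV. q i) = 0"
  proof -
    have s: "(\<Sum>i\<in>UNIV. q i) \<in> ?V" using qV by (intro subspace_sum subspace_zero_sum_space)
    have "(\<Sum>i\<in>UNIV. q i) \<bullet> (\<Sum>i\<in>UNIV. q i) = (\<Sum>j\<in>UNIV. (\<Sum>i\<in>UNIV. q i) $ j)"
      by (subst inner_sum_left) (simp only: q[OF s])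
    then show ?thesis using sum_zero_sum_space[OF s] by simp
  qed
  have zero: "0 \<in> convex hull (range q)"
    unfolding convex_hull_range
    by (rule CollectI, rule exI[of _ "\<lambda>_. 1 / real CARD('n mod_ring \<times> 'n mod_ring)"])
      (use sum_q in \<open>simp flip: scaleR_sum_right\<close>)
  have P_eq: "P = {y \<in> ?V. \<forall>p\<in>range q. -1 \<le> p \<bullet> y}"
    unfolding P_def shifted_dilate_eq_halfspaces using q by auto
  have qsub: "range q \<subseteq> ?V" using qV by auto
  note halfspaces = subspace_zero_sum_space finite_imageI[OF finite] qsub zero
  have span: "span P = ?V" unfolding P_eq by (rule span_halfspaces[OF halfspaces])
  have interior: "0 \<in> rel_interior P"
    unfolding P_eq by (rule zero_in_rel_interior_halfspaces[OF halfspaces])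
  have polar: "polar_polytope P = convex hull (range q)"
    unfolding P_eq by (rule polar_polytope_halfspaces[OF halfspaces])
  have ones: "all_ones \<in> ?L" by (simp add: integer_lattice_def all_ones_def)
  have rows: "finite (rows (Q_matrix :: real ^ ('n mod_ring \<times> 'n mod_ring) ^ _))"
    by (simp add: rows_eq_range)
  have rows_L: "rows Q_matrix \<subseteq> ?L"
    by (auto simp: rows_def row_def integer_lattice_def) (metis Ints_0 Ints_1 Q_matrix_Inl Q_matrix_Inr old.sum.exhaust)
  have lattice_Q: "lattice_polytope ?L ?Q"
    unfolding Q_polytope_def using rows rows_L by (rule lattice_polytope_convex_hull)
  have "lattice_polytope ?L P"
  proof -
    let ?W = "(\<lambda>x. - all_ones + ?n *\<^sub>R x) ` rows Q_matrix"
    have "P = convex hull ?W"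
      using convex_hull_affinity[of "- all_ones :: real ^ ('n mod_ring \<times> 'n mod_ring)" ?n "rows Q_matrix"]
      by (simp add: P_def Q_polytope_def)
    moreover have "?W \<subseteq> ?L"
      using rows_L ones by (auto simp: integer_lattice_def subset_iff intro!: Ints_diff Ints_mult)
    ultimately show ?thesis using rows by (simp add: lattice_polytope_convex_hull)
  qed
  moreover have "v \<in> span P" if "v extreme_point_of P" for v
    using that by (simp add: extreme_point_of_def span_base)
  ultimately have lattice_P: "lattice_polytope (?L \<inter> span P) P"
    by (auto simp: lattice_polytope_def)
  have "range q \<subseteq> dual_lattice (span P) ?L"
    using qV q by (auto simp: dual_lattice_def span integer_lattice_def)
  then have "lattice_polytope (dual_lattice (span P) ?L) (polar_polytope P)"
    unfolding polar by (intro lattice_polytope_convex_hull) auto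
  then have refl: "reflexive_polytope ?L P"
    using lattice_P interior by (simp add: reflexive_polytope_def)
  have "(*\<^sub>R) ?n ` ?Q = (\<lambda>x. all_ones + x) ` P"
    by (simp add: P_def image_image)
  then have "all_ones \<in> rel_interior ((*\<^sub>R) ?n ` ?Q)"
    using interior by (auto simp: rel_interior_translation image_iff)
  then show ?thesis
    unfolding Gorenstein_polytope_def using lattice_Q ones refl[unfolded P_def] by auto
qed


section \<open>Lattice frames of the polytope\<close>

text \<open>
  The frame has the first upper vertex as its origin and the lower vertex \<open>j\<close> is left out, so that
  the weights of a point become unique. The enumeration \<open>e\<close> lists the other vertices, since a lattice
  frame is indexed by natural numbers.
\<close>
locale omitted_vertex_frame =
  fixes j :: "'n::nontriv mod_ring" and d :: nat and e :: "nat \<Rightarrow> 'n mod_ring + 'n mod_ring"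
  assumes enum: "bij_betw e {..<d} (- {Inl 0, Inr j})"
begin

abbreviation origin :: "real ^ ('n mod_ring \<times> 'n mod_ring)" where
  "origin \<equiv> Q_matrix $ Inl 0"

definition direction :: "nat \<Rightarrow> real ^ ('n mod_ring \<times> 'n mod_ring)" where
  "direction i = Q_matrix $ e i - origin"

lemma enum_neq: "i < d \<Longrightarrow> e i \<noteq> Inl 0" "i < d \<Longrightarrow> e i \<noteq> Inr j"
  using bij_betw_apply[OF enum] by auto

lemma enum_ex:
  assumes "r \<noteq> Inl 0" "r \<noteq> Inr j"
  obtains i where "i < d" "r = e i"
proof -
  have "r \<in> e ` {..<d}" using assms bij_betw_imp_surj_on[OF enum] by auto
  then show thesis using that by auto
qed

lemma sum_weights:
  fixes g :: "_ \<Rightarrow> real"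
  assumes "g (Inr j) = 0"
  shows "sum g UNIV = g (Inl 0) + (\<Sum>i<d. g (e i))"
proof -
  have "sum g UNIV = sum g ({Inl 0, Inr j} \<union> - {Inl 0, Inr j})" by (rule sum.cong) auto
  also have "\<dots> = sum g {Inl 0, Inr j} + sum g (- {Inl 0, Inr j})"
    by (rule sum.union_disjoint) auto
  also have "sum g (- {Inl 0, Inr j}) = (\<Sum>i<d. g (e i))"
    using sum.reindex_bij_betw[OF enum, of g] by simp
  finally show ?thesis using assms by simp
qed

lemma chart_eq_vertex_comb:
  assumes "g (Inr j) = 0" "sum g UNIV = 1"
  shows "origin + (\<Sum>i<d. g (e i) *\<^sub>R direction i) = vertex_comb g"
proof -
  have "(\<Sum>i<d. g (e i) *\<^sub>R direction i) = (\<Sum>r\<in>- {Inl 0, Inr j}. g r *\<^sub>R (Q_matrix $ r - origin))"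
    using sum.reindex_bij_betw[OF enum, of "\<lambda>r. g r *\<^sub>R (Q_matrix $ r - origin)"]
    by (simp add: direction_def)
  also have "\<dots> = (\<Sum>r\<in>UNIV. g r *\<^sub>R (Q_matrix $ r - origin))"
    by (rule sum.mono_neutral_left) (use assms in auto)
  also have "\<dots> = vertex_comb g - origin"
    by (simp add: vertex_comb_def scaleR_diff_right sum_subtractf assms flip: scaleR_sum_left)
  finally show ?thesis by simp
qed

definition weights :: "(nat \<Rightarrow> real) \<Rightarrow> 'n mod_ring + 'n mod_ring \<Rightarrow> real" where
  "weights x r = (if r = Inl 0 then 1 - (\<Sum>i<d. x i) else if r = Inr j then 0
    else x (inv_into {..<d} e r))"

lemma weights_simps [simp]:
  "weights x (Inl 0) = 1 - (\<Sum>i<d. x i)"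
  "weights x (Inr j) = 0"
  "i < d \<Longrightarrow> weights x (e i) = x i"
  using enum_neq enum by (auto simp: weights_def bij_betw_def inv_into_f_f)

lemma sum_weights_eq_1 [simp]: "sum (weights x) UNIV = 1"
  by (simp add: sum_weights)

lemma chart: "origin + (\<Sum>i<d. x i *\<^sub>R direction i) = vertex_comb (weights x)"
  using chart_eq_vertex_comb[of "weights x"] by simp

lemma weights_eqI:
  assumes "g (Inr j) = 0" "sum g UNIV = 1"
  shows "weights (\<lambda>i. g (e i)) = g"
  by (rule vertex_comb_inject[of _ _ j])
    (simp_all add: assms chart_eq_vertex_comb[OF assms] flip: chart)

lemma affine_hull_range_chart:
  "affine hull Q_polytope = range (\<lambda>x. origin + (\<Sum>i<d. x i *\<^sub>R direction i))"
proof (intro equalityI subsetI)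
  fix y :: "real ^ ('n mod_ring \<times> 'n mod_ring)"
  assume "y \<in> affine hull Q_polytope"
  then obtain g where g: "y = vertex_comb g" "sum g UNIV = 1" by (auto simp: affine_hull_Q_polytope)
  define h where "h = shift_weights (g (Inr j)) g"
  have "y = vertex_comb h" "h (Inr j) = 0" "sum h UNIV = 1" by (simp_all add: h_def g)
  then show "y \<in> range (\<lambda>x. origin + (\<Sum>i<d. x i *\<^sub>R direction i))"
    using weights_eqI[of h] unfolding chart by (metis rangeI)
next
  fix y assume "y \<in> range (\<lambda>x. origin + (\<Sum>i<d. x i *\<^sub>R direction i))"
  then show "y \<in> affine hull Q_polytope"
    unfolding chart affine_hull_Q_polytope using sum_weights_eq_1 by blast
qed

lemma directions_independent:
  assumes "(\<Sum>i<d. x i *\<^sub>R direction i) = 0"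
  shows "\<forall>i<d. x i = 0"
proof -
  have "vertex_comb (weights x) = vertex_comb (weights (\<lambda>_. 0))"
    using assms by (simp flip: chart)
  then have "weights x = weights (\<lambda>_. 0)" by (rule vertex_comb_inject[of _ _ j]) simp
  then show ?thesis by (metis weights_simps(3))
qed

lemma aff_dim_Q_polytope:
  "aff_dim (Q_polytope :: (real ^ ('n mod_ring \<times> 'n mod_ring)) set) = int d"
proof -
  have "aff_dim (Q_polytope :: (real ^ ('n mod_ring \<times> 'n mod_ring)) set) =
      aff_dim ((+) origin ` span (direction ` {..<d}))"
    by (subst aff_dim_affine_hull[symmetric])
      (simp add: affine_hull_range_chart span_family image_image)
  also have "\<dots> = int (dim (direction ` {..<d}))"
    by (simp add: aff_dim_translation_eq aff_dim_subspace)
  also have "dim (direction ` {..<d}) = card (direction ` {..<d})"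
    by (rule dim_eq_card_independent) (rule independent_image_family[OF directions_independent])
  also have "\<dots> = d"
    using card_image[OF inj_on_independent_family[OF directions_independent]] by simp
  finally show ?thesis .
qed

text \<open>
  The frame coordinates of a point are its weights normalized at \<open>j\<close>, and these are integers exactly
  for lattice points.
\<close>
lemma lattice_frame_omitted_vertex:
  "lattice_frame integer_lattice Q_polytope origin direction"
proof -
  have "integer_lattice \<inter> affine hull Q_polytope =
      {origin + (\<Sum>i<d. of_int (c i) *\<^sub>R direction i) |c :: nat \<Rightarrow> int. c \<in> UNIV}" (is "?L = ?R")
  proof (intro equalityI subsetI)
    fix y assume y: "y \<in> ?L"
    then obtain x where x: "y = vertex_comb (weights x)"
      by (auto simp: affine_hull_range_chart chart)
    then have "weights x r \<in> \<int>" for r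
      using y vertex_comb_in_lattice_iff[of "weights x" j] by auto
    then have "x i \<in> \<int>" if "i < d" for i using that by (metis weights_simps(3))
    then have "(\<Sum>i<d. x i *\<^sub>R direction i) = (\<Sum>i<d. of_int \<lfloor>x i\<rfloor> *\<^sub>R direction i)"
      by (intro sum.cong) (auto elim!: Ints_cases)
    then have "y = origin + (\<Sum>i<d. of_int \<lfloor>x i\<rfloor> *\<^sub>R direction i)"
      unfolding x chart[symmetric] by simp
    then show "y \<in> ?R" by (intro CollectI exI[of _ "\<lambda>i. \<lfloor>x i\<rfloor>"]) simp
  next
    fix y assume "y \<in> ?R"
    then obtain c :: "nat \<Rightarrow> int" where y: "y = origin + (\<Sum>i<d. of_int (c i) *\<^sub>R direction i)" by auto
    have "weights (\<lambda>i. of_int (c i)) r \<in> \<int>" for r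
      by (auto simp: weights_def)
    then have "y \<in> integer_lattice"
      unfolding y chart using vertex_comb_in_lattice_iff[of "weights (\<lambda>i. of_int (c i))" j] by simp
    then show "y \<in> ?L" unfolding affine_hull_range_chart y by auto
  qed
  then show ?thesis
    using inj_on_independent_family[where d = d and b = direction, OF directions_independent]
      independent_image_family[where d = d and b = direction, OF directions_independent]
    by (simp add: lattice_frame_def aff_dim_Q_polytope)
qed

end

section \<open>The volume\<close>

text \<open>
  The coordinate at \<open>(- b, 0)\<close> is the upper weight of \<open>0\<close> plus the lower weight of \<open>b\<close>, so the
  condition says that \<open>j\<close> has the smallest lower weight. In this form the set is visibly closed, and
  visibly the sets for all \<open>j\<close> cover the polytope.
\<close>
definition omitted_vertex_simplex ::
  "'n::nontriv mod_ring \<Rightarrow> (real ^ ('n mod_ring \<times> 'n mod_ring)) set" where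
  "omitted_vertex_simplex j = {x \<in> Q_polytope. \<forall>b. x $ (- j, 0) \<le> x $ (- b, 0)}"

lemma compact_Q_polytope: "compact Q_polytope"
  unfolding Q_polytope_def by (intro finite_imp_compact_convex_hull) (simp add: rows_eq_range)

lemma borel_omitted_vertex_simplex [measurable]: "omitted_vertex_simplex j \<in> sets borel"
proof -
  have "omitted_vertex_simplex j = Q_polytope \<inter> (\<Inter>b. {x. x $ (- j, 0) \<le> x $ (- b, 0)})"
    by (auto simp: omitted_vertex_simplex_def)
  moreover have "closed \<dots>"
    by (intro closed_Int closed_INT ballI compact_imp_closed compact_Q_polytope closed_Collect_le
        continuous_intros)
  ultimately show ?thesis by simp
qed

text \<open>
  Moving the lower weight of \<open>j\<close> to the upper side keeps all weights nonnegative, because it is the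
  smallest one: the set is the simplex on the vertices other than \<open>j\<close>.
\<close>
lemma omitted_vertex_simplex_eq:
  "omitted_vertex_simplex j =
    {vertex_comb g |g. (\<forall>r. 0 \<le> g r) \<and> sum g UNIV = 1 \<and> g (Inr j) = 0}"
proof (intro equalityI subsetI)
  fix x assume x: "x \<in> omitted_vertex_simplex j"
  then obtain g where g: "x = vertex_comb g" "\<forall>r. 0 \<le> g r" "sum g UNIV = 1"
    by (auto simp: omitted_vertex_simplex_def Q_polytope_eq)
  have le: "g (Inr j) \<le> g (Inr b)" for b
    using x by (auto simp: omitted_vertex_simplex_def g(1) vertex_comb_nth)
  have "0 \<le> shift_weights (g (Inr j)) g r" for r
    using g(2) le by (cases r) auto
  then show "x \<in> {vertex_comb g |g. (\<forall>r. 0 \<le> g r) \<and> sum g UNIV = 1 \<and> g (Inr j) = 0}"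
    using g by (intro CollectI exI[of _ "shift_weights (g (Inr j)) g"]) simp
next
  fix x assume "x \<in> {vertex_comb g |g. (\<forall>r. 0 \<le> g r) \<and> sum g UNIV = 1 \<and> g (Inr j) = 0}"
  then show "x \<in> omitted_vertex_simplex j"
    by (auto simp: omitted_vertex_simplex_def Q_polytope_eq vertex_comb_nth)
qed

lemma Union_omitted_vertex_simplex: "(\<Union>j. omitted_vertex_simplex j) = Q_polytope"
proof (intro equalityI subsetI)
  fix x :: "real ^ ('a mod_ring \<times> 'a mod_ring)" assume x: "x \<in> Q_polytope"
  define c where "c = Min (range (\<lambda>b. x $ (- b, 0)))"
  have "c \<in> range (\<lambda>b. x $ (- b, 0))" unfolding c_def by (rule Min_in) auto
  then obtain j where j: "c = x $ (- j, 0)" by auto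
  have "c \<le> x $ (- b, 0)" for b by (simp add: c_def)
  then have "x \<in> omitted_vertex_simplex j" using x by (simp add: omitted_vertex_simplex_def j)
  then show "x \<in> (\<Union>j. omitted_vertex_simplex j)" by blast
qed (auto simp: omitted_vertex_simplex_def)

context omitted_vertex_frame
begin

abbreviation coordinates :: "(nat \<Rightarrow> real) measure" where
  "coordinates \<equiv> \<Pi>\<^sub>M i\<in>{..<d}. lborel"

lemma chart_in_simplex_iff:
  "origin + (\<Sum>i<d. x i *\<^sub>R direction i) \<in> omitted_vertex_simplex j \<longleftrightarrow>
    (\<forall>i\<in>{..<d}. 0 \<le> x i) \<and> sum x {..<d} \<le> 1" (is "?lhs \<longleftrightarrow> ?rhs")
proof
  assume ?lhs
  then obtain g where g: "vertex_comb (weights x) = vertex_comb g" "\<forall>r. 0 \<le> g r" "g (Inr j) = 0"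
    unfolding chart omitted_vertex_simplex_eq by auto
  have "weights x = g" by (rule vertex_comb_inject[OF g(1), of j]) (simp add: g(3))
  then have pos: "0 \<le> weights x r" for r using g(2) by simp
  show ?rhs
    using pos[of "Inl 0"] pos[of "e i" for i] by (auto, metis weights_simps(3))
next
  assume ?rhs
  then have "0 \<le> weights x r" for r
  proof -
    consider "r = Inl 0" | "r = Inr j" | i where "i < d" "r = e i" using enum_ex by metis
    then show ?thesis using \<open>?rhs\<close> by cases auto
  qed
  then show ?lhs
    unfolding chart omitted_vertex_simplex_eq by (intro CollectI exI[of _ "weights x"]) simp
qed

text \<open>In its own frame the simplex is the standard simplex.\<close>
lemma emeasure_omitted_vertex_simplex:
  "emeasure coordinates {x \<in> space coordinates.
    origin + (\<Sum>i<d. x i *\<^sub>R direction i) \<in> omitted_vertex_simplex j} = ennreal (1 / fact d)"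
proof -
  have "{x \<in> space coordinates. origin + (\<Sum>i<d. x i *\<^sub>R direction i) \<in> omitted_vertex_simplex j} =
      {x. (\<forall>i\<in>{..<d}. 0 \<le> x i) \<and> sum x {..<d} \<le> 1} \<inter> space coordinates"
    unfolding chart_in_simplex_iff by auto
  then show ?thesis using emeasure_std_simplex_aux[of "{..<d}" 1] by simp
qed

text \<open>
  On the overlap the lower weights of \<open>j\<close> and \<open>k\<close> are both smallest, hence equal. In the frame that
  omits \<open>j\<close> this puts the overlap into a coordinate hyperplane.
\<close>
lemma emeasure_omitted_vertex_simplex_Int:
  assumes "k \<noteq> j"
  shows "emeasure coordinates {x \<in> space coordinates.
    origin + (\<Sum>i<d. x i *\<^sub>R direction i) \<in> omitted_vertex_simplex j \<inter> omitted_vertex_simplex k} = 0"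
proof -
  obtain i where i: "i < d" "Inr k = e i" using enum_ex[of "Inr k"] assms by auto
  let ?H = "PiE {..<d} (\<lambda>l. if l = i then {0} else UNIV) :: (nat \<Rightarrow> real) set"
  interpret product_sigma_finite "\<lambda>_::nat. lborel :: real measure"
    by standard
  have "{x \<in> space coordinates.
      origin + (\<Sum>i<d. x i *\<^sub>R direction i) \<in> omitted_vertex_simplex j \<inter> omitted_vertex_simplex k} \<subseteq> ?H"
  proof
    fix x assume "x \<in> {x \<in> space coordinates.
      origin + (\<Sum>i<d. x i *\<^sub>R direction i) \<in> omitted_vertex_simplex j \<inter> omitted_vertex_simplex k}"
    then have x: "x \<in> space coordinates"
      and j: "origin + (\<Sum>i<d. x i *\<^sub>R direction i) \<in> omitted_vertex_simplex j"
      and k: "origin + (\<Sum>i<d. x i *\<^sub>R direction i) \<in> omitted_vertex_simplex k"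
      by auto
    have "0 \<le> x i" using j i unfolding chart_in_simplex_iff by simp
    moreover have "x i \<le> 0"
    proof -
      have "weights x (Inr k) \<le> weights x (Inr j)"
        using k by (auto simp: chart omitted_vertex_simplex_def vertex_comb_nth simp del: weights_simps)
      then show ?thesis using i by simp
    qed
    ultimately show "x \<in> ?H" using x by (auto simp: space_PiM PiE_iff)
  qed
  moreover have "?H \<in> null_sets coordinates"
  proof (rule null_setsI)
    have "emeasure coordinates ?H = (\<Prod>l<d. emeasure lborel (if l = i then {0} else UNIV :: real set))"
      by (rule emeasure_PiM) auto
    \<comment> \<open>One factor is zero and the others are infinite; their product in \<open>ennreal\<close> is zero.\<close>
    also have "\<dots> = 0" using i(1) by (intro prod_zero bexI[of _ i]) auto
    finally show "emeasure coordinates ?H = 0" .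
    show "?H \<in> sets coordinates" by (rule sets_PiM_I_finite) auto
  qed
  ultimately show ?thesis by (metis (no_types, lifting) emeasure_mono null_setsD1 null_setsD2 le_zero_eq)
qed

end

lemma omitted_vertex_frame_exists:
  fixes j :: "'n::nontriv mod_ring"
  obtains e where "omitted_vertex_frame j (2 * CARD('n) - 2) e"
proof -
  define S where "S = {Inl 0 :: 'n mod_ring + 'n mod_ring, Inr j}"
  have "card (- S) = CARD('n mod_ring + 'n mod_ring) - card S"
    unfolding Compl_eq_Diff_UNIV by (rule card_Diff_subset) auto
  then have "card {..<2 * CARD('n) - 2} = card (- {Inl 0 :: 'n mod_ring + 'n mod_ring, Inr j})"
    by (simp add: S_def card_UNIV_sum)
  then obtain e where "bij_betw e {..<2 * CARD('n) - 2} (- {Inl 0 :: 'n mod_ring + 'n mod_ring, Inr j})"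
    using finite_same_card_bij[OF finite_lessThan finite] by blast
  then show thesis by (intro that) (rule omitted_vertex_frame.intro)
qed

text \<open>
  An index type for the coordinates of a space of the dimension of the polytope. The order is there
  because the formula for the measure of a linear image asks for a well-ordered index type.
\<close>
typedef ('n::nontriv) coordinate = "{..<2 * CARD('n) - 2}"
  using nontriv[where ?'a = 'n] by (intro exI[of _ 0]) simp

lemma CARD_coordinate: "CARD('n::nontriv coordinate) = 2 * CARD('n) - 2"
  using type_definition.card[OF type_definition_coordinate] by simp

instance coordinate :: (nontriv) finite
proof
  show "finite (UNIV :: 'a coordinate set)"
    unfolding type_definition.univ[OF type_definition_coordinate] by simp
qed

instantiation coordinate :: (nontriv) wellorder
begin

definition "x \<le> y \<longleftrightarrow> Rep_coordinate x \<le> Rep_coordinate y"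
definition "x < y \<longleftrightarrow> Rep_coordinate x < Rep_coordinate y"

instance
proof
  fix P :: "'a coordinate \<Rightarrow> bool" and a
  assume step: "\<And>x. (\<And>y. y < x \<Longrightarrow> P y) \<Longrightarrow> P x"
  show "P a"
  proof (induction "Rep_coordinate a" arbitrary: a rule: less_induct)
    case less
    show ?case by (rule step, rule less) (simp add: less_coordinate_def)
  qed
qed (auto simp: less_eq_coordinate_def less_coordinate_def Rep_coordinate_inject)

end

text \<open>
  The volume is the sum of the volumes of the \<open>n\<close> simplices, since these overlap in null sets. Each
  simplex may be measured in the frame that omits its vertex instead of the given frame.
\<close>
lemma frame_volume_Q_polytope:
  fixes p :: "real ^ ('n::nontriv mod_ring \<times> 'n mod_ring)"
  assumes F: "lattice_frame integer_lattice Q_polytope p b"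
  shows "frame_volume Q_polytope p b = CARD('n)"
proof -
  let ?Q = "Q_polytope :: (real ^ ('n mod_ring \<times> 'n mod_ring)) set"
  define d where "d = 2 * CARD('n) - 2"
  define M where "M = (\<Pi>\<^sub>M i\<in>{..<d}. lborel :: real measure)"
  define part where "part T = {x \<in> space M. p + (\<Sum>i<d. x i *\<^sub>R b i) \<in> T}" for T
  have "\<exists>e. \<forall>j :: 'n mod_ring. omitted_vertex_frame j d (e j)"
    unfolding d_def using omitted_vertex_frame_exists by metis
  then obtain e where e: "\<And>j :: 'n mod_ring. omitted_vertex_frame j d (e j)" by blast
  have dim: "nat (aff_dim ?Q) = d"
    using omitted_vertex_frame.aff_dim_Q_polytope[OF e] by simp
  have part_sets: "part T \<in> sets M" if "T \<in> sets borel" for T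
  proof -
    have "(\<lambda>x. p + (\<Sum>i<d. x i *\<^sub>R b i)) \<in> borel_measurable M"
      unfolding M_def by measurable
    from measurable_sets[OF this that] show ?thesis
      by (simp add: part_def vimage_def Int_def conj_commute)
  qed
  have frame: "emeasure M (part T) = emeasure M {x \<in> space M. Q_matrix $ Inl 0 +
      (\<Sum>i<d. x i *\<^sub>R omitted_vertex_frame.direction (e j) i) \<in> T}" if "T \<in> sets borel" for T j
    using emeasure_frame_unique[OF F omitted_vertex_frame.lattice_frame_omitted_vertex[OF e[of j]] _ that,
        where ?'d = "'n coordinate"]
    by (simp add: dim CARD_coordinate M_def part_def flip: d_def)
  have simplex: "emeasure M (part (omitted_vertex_simplex j)) = ennreal (1 / fact d)" for j
    using frame[of "omitted_vertex_simplex j" j, OF borel_omitted_vertex_simplex]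
      omitted_vertex_frame.emeasure_omitted_vertex_simplex[OF e[of j]]
    by (simp add: M_def)
  have overlap: "part (omitted_vertex_simplex j) \<inter> part (omitted_vertex_simplex k) \<in> null_sets M"
    if "k \<noteq> j" for j k
  proof -
    have eq: "part (omitted_vertex_simplex j) \<inter> part (omitted_vertex_simplex k) =
        part (omitted_vertex_simplex j \<inter> omitted_vertex_simplex k)" by (auto simp: part_def)
    have meas: "omitted_vertex_simplex j \<inter> omitted_vertex_simplex k \<in> sets borel" by measurable
    show ?thesis
      unfolding eq
    proof (rule null_setsI)
      show "emeasure M (part (omitted_vertex_simplex j \<inter> omitted_vertex_simplex k)) = 0"
        unfolding frame[OF meas, of j]
        using omitted_vertex_frame.emeasure_omitted_vertex_simplex_Int[OF e that]
        by (simp add: M_def)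
    qed (rule part_sets[OF meas])
  qed
  have "measure M (part ?Q) = measure M (\<Union>j\<in>UNIV. part (omitted_vertex_simplex j))"
    unfolding Union_omitted_vertex_simplex[symmetric] by (rule arg_cong[of _ _ "measure M"]) (auto simp: part_def)
  also have "\<dots> = (\<Sum>j\<in>(UNIV :: 'n mod_ring set). measure M (part (omitted_vertex_simplex j)))"
  proof (rule measure_UNION_AE)
    show "part (omitted_vertex_simplex j) \<in> fmeasurable M" for j
      by (rule fmeasurableI) (simp_all add: part_sets simplex)
    show "pairwise (\<lambda>j k. AE x in M. x \<notin> part (omitted_vertex_simplex j) \<or> x \<notin> part (omitted_vertex_simplex k)) UNIV"
    proof (rule pairwiseI)
      fix j k :: "'n mod_ring" assume "j \<noteq> k"
      from AE_not_in[OF overlap[OF this[symmetric]]]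
      show "AE x in M. x \<notin> part (omitted_vertex_simplex j) \<or> x \<notin> part (omitted_vertex_simplex k)" by simp
    qed
  qed simp
  also have "\<dots> = CARD('n) / fact d"
    by (simp add: measure_def simplex)
  finally have "measure M (part ?Q) = CARD('n) / fact d" .
  then show ?thesis
    by (simp add: frame_volume_def dim M_def part_def)
qed

theorem normalized_volume_Q_polytope:
  "normalized_volume integer_lattice
    (Q_polytope :: (real ^ ('n::nontriv mod_ring \<times> 'n mod_ring)) set) = CARD('n)"
proof -
  obtain e where "omitted_vertex_frame (0 :: 'n mod_ring) (2 * CARD('n) - 2) e" by (rule omitted_vertex_frame_exists)
  note frame = omitted_vertex_frame.lattice_frame_omitted_vertex[OF this]
  show ?thesis
    unfolding normalized_volume_def
  proof (rule the_equality)
    show "\<exists>p b. lattice_frame integer_lattice (Q_polytope :: (real ^ ('n mod_ring \<times> 'n mod_ring)) set) p b \<and>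
        real CARD('n) = frame_volume Q_polytope p b"
      using frame frame_volume_Q_polytope[OF frame] by metis
  qed (auto simp: frame_volume_Q_polytope)
qed

theorem proposition5p1:
  fixes n :: nat
  assumes "n = CARD('n::nontriv)" and "n \<ge> 2"
  shows "Gorenstein_polytope integer_lattice
           (Q_polytope :: (real ^ ('n mod_ring \<times> 'n mod_ring)) set) n \<and>
         normalized_volume integer_lattice
           (Q_polytope :: (real ^ ('n mod_ring \<times> 'n mod_ring)) set) = real n"
  unfolding assms(1) using Gorenstein_Q_polytope normalized_volume_Q_polytope by blast

end
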